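(* Let $R_0\in B(H)_+$ and let $(R_n)_{n\ge 0}\subset B(H)_+$ and $(E_n)_{n\ge 0}\subset H$ satisfy $R_{n+1}=R_n-|E_n\rangle\langle E_n|$ for all $n\ge 0$. Assume that: (1) for every $n$ with $E_n\neq 0$, we have $E_n\in\operatorname{ran}(R_n^{1/2})$; (2) for every $n$, $\langle E_n,R_n^\dagger E_n\rangle=1$, where $R_n^\dagger$ is the Moore-Penrose inverse of $R_n$. Then there exists a sequence of unit vectors $(u_n)_{n\ge 0}\subset H$ such that $R_{n+1}=\Phi_{u_n}(R_n)=R_n^{1/2}(I-P_n)R_n^{1/2}$, with $P_n=|u_n\rangle\langle u_n|$, for all $n\ge 0$, and $E_n=R_n^{1/2}u_n$ for all $n\ge 0$. In particular, the chain $(R_n)$ arises from a residual-weighted iteration with residual vectors $E_n$. Conversely, suppose $R_0\in B(H)_+$ and a sequence of unit vectors $(u_n)_{n\ge 0}\subset H$ are given such that $u_n\in\operatorname{supp}(R_n)$, where $R_{n+1}=\Phi_{u_n}(R_n)$ and $E_n=R_n^{1/2}u_n$. Then each $E_n$ lies in $\operatorname{ran}(R_n^{1/2})$, and the normalization condition $\langle E_n,R_n^\dagger E_n\rangle=1$ holds for all $n\ge 0$.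
   Context: $H$ is a complex Hilbert space and $B(H)_+$ is the set of bounded positive operators on $H$. Inner products are linear in the second variable, and $|a\rangle\langle b|$ denotes the operator $x\mapsto\langle b,x\rangle a$. For a unit vector $u\in H$ and $R\in B(H)_+$, the residual-weighted rank-one update is $\Phi_u(R)=R^{1/2}(I-|u\rangle\langle u|)R^{1/2}\in B(H)_+$. A residual-weighted iteration is a sequence $R_{n+1}=\Phi_{u_n}(R_n)$ for unit vectors $u_n$, and its residual vectors are $E_n=R_n^{1/2}u_n$. For $R\in B(H)_+$, $\operatorname{supp}(R)=\overline{\operatorname{ran}}(R)=\ker(R)^\perp$ is the range of the support projection of $R$. The Moore-Penrose inverse $R^\dagger$ of $R$ is the operator that vanishes on $\ker(R)$ and inverts the restriction of $R$ to $\operatorname{supp}(R)$.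
   Formalization: ⟨E_n, R_n†E_n⟩ is read as the closed quadratic form of the possibly unbounded R_n† (the square norm of the preimage of E_n under R_n^{1/2} in the support), since R_n†E_n may be undefined when ran(R_n) is not closed; the two agree whenever R_n†E_n is defined. *)

theory Defs
  imports "HOL-Analysis.Analysis"
begin

section \<open>Complex Hilbert spaces\<close>

text \<open>
  A complex Hilbert space is rendered as a complete real inner product space with a compatible
  complex structure: \<open>cinner\<close> is linear in its second argument, and the real inner product
  is its real part. Hence the norm of the underlying real space is the Hilbert space norm.
\<close>

class complex_hilbert_space = real_inner + banach +
  fixes scaleC :: "complex \<Rightarrow> 'a \<Rightarrow> 'a"  (infixr \<open>*\<^sub>C\<close> 75)
    and cinner :: "'a \<Rightarrow> 'a \<Rightarrow> complex"
  assumes scaleC_add_right: "c *\<^sub>C (x + y) = c *\<^sub>C x + c *\<^sub>C y"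
    and scaleC_add_left: "(c + d) *\<^sub>C x = c *\<^sub>C x + d *\<^sub>C x"
    and scaleC_scaleC: "c *\<^sub>C d *\<^sub>C x = (c * d) *\<^sub>C x"
    and scaleC_one: "1 *\<^sub>C x = x"
    and scaleR_scaleC: "r *\<^sub>R x = complex_of_real r *\<^sub>C x"
    and cinner_add_right: "cinner x (y + z) = cinner x y + cinner x z"
    and cinner_scaleC_right: "cinner x (c *\<^sub>C y) = c * cinner x y"
    and cinner_commute: "cinner x y = cnj (cinner y x)"
    and inner_eq_Re_cinner: "inner x y = Re (cinner x y)"

text \<open>The scalars themselves form an instance.\<close>

instantiation complex :: complex_hilbert_space
begin
definition scaleC_complex :: "complex \<Rightarrow> complex \<Rightarrow> complex" where
  "scaleC_complex c z = c * z"
definition cinner_complex :: "complex \<Rightarrow> complex \<Rightarrow> complex" where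
  "cinner_complex w z = cnj w * z"
instance
  by standard (auto simp: scaleC_complex_def cinner_complex_def algebra_simps scaleR_conv_of_real
      inner_complex_def)
end

lemma cinner_add_left: "cinner (x + y) z = cinner x z + cinner y z"
  for x :: "'a::complex_hilbert_space"
  by (metis cinner_add_right cinner_commute complex_cnj_add)

lemma cinner_scaleC_left: "cinner (c *\<^sub>C x) y = cnj c * cinner x y"
  for x :: "'a::complex_hilbert_space"
  by (metis cinner_commute cinner_scaleC_right complex_cnj_mult)

lemma cinner_scaleR_right: "cinner x (r *\<^sub>R y) = of_real r * cinner x y"
  for x :: "'a::complex_hilbert_space"
  by (simp add: scaleR_scaleC cinner_scaleC_right)

lemma cinner_zero_right [simp]: "cinner x 0 = 0" for x :: "'a::complex_hilbert_space"
  using cinner_add_right[of x 0 0] by simp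

lemma cinner_zero_left [simp]: "cinner 0 x = 0" for x :: "'a::complex_hilbert_space"
  using cinner_add_left[of 0 0 x] by simp

lemma cinner_self: "cinner x x = of_real ((norm x)\<^sup>2)" for x :: "'a::complex_hilbert_space"
proof (rule complex_eqI)
  show "Re (cinner x x) = Re (of_real ((norm x)\<^sup>2))"
    by (simp flip: inner_eq_Re_cinner add: dot_square_norm)
  show "Im (cinner x x) = Im (of_real ((norm x)\<^sup>2))"
    using cinner_commute[of x x] by (simp add: complex_eq_iff)
qed

lemma norm_scaleC: "norm (c *\<^sub>C x) = cmod c * norm x" for x :: "'a::complex_hilbert_space"
proof -
  have "complex_of_real ((norm (c *\<^sub>C x))\<^sup>2) = c * cnj c * cinner x x"
    by (simp only: cinner_self[symmetric] cinner_scaleC_left cinner_scaleC_right ac_simps)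
  also have "\<dots> = of_real ((cmod c * norm x)\<^sup>2)"
    by (simp add: cinner_self complex_mult_cnj cmod_power2 power_mult_distrib)
  finally have "(norm (c *\<^sub>C x))\<^sup>2 = (cmod c * norm x)\<^sup>2"
    using of_real_eq_iff by blast
  then show ?thesis
    by (simp add: power2_eq_iff_nonneg)
qed

lemma norm_cinner_le: "cmod (cinner x y) \<le> norm x * norm y"
  for x :: "'a::complex_hilbert_space"
proof (cases "cinner x y = 0")
  case False
  define c where "c = cnj (cinner x y) / cmod (cinner x y)"
  have c: "cmod c = 1"
    using False by (simp add: c_def norm_divide)
  have "c * cinner x y = complex_of_real ((cmod (cinner x y))\<^sup>2) / cmod (cinner x y)"
    by (simp only: c_def complex_norm_square mult.commute[of "cinner x y"] times_divide_eq_left)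
  also have "\<dots> = cmod (cinner x y)"
    using False by (simp add: power2_eq_square)
  finally have "c * cinner x y = cmod (cinner x y)" .
  then have "cmod (cinner x y) = inner x (c *\<^sub>C y)"
    by (simp add: inner_eq_Re_cinner cinner_scaleC_right)
  also have "\<dots> \<le> norm x * norm (c *\<^sub>C y)"
    by (rule norm_cauchy_schwarz)
  finally show ?thesis
    by (simp add: norm_scaleC c)
qed simp

section \<open>Bounded operators\<close>

text \<open>
  Bounded operators on \<open>H\<close> are the bounded real-linear maps \<open>'a \<Rightarrow>\<^sub>L 'a\<close>
  that commute with complex scalars.
\<close>

definition complex_linear :: "('a::complex_hilbert_space \<Rightarrow>\<^sub>L 'a) \<Rightarrow> bool" where
  "complex_linear T \<longleftrightarrow> (\<forall>c x. T (c *\<^sub>C x) = c *\<^sub>C T x)"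
definition positive_ops :: "('a::complex_hilbert_space \<Rightarrow>\<^sub>L 'a) set" where
  "positive_ops = {T. complex_linear T \<and>
     (\<forall>x. Im (cinner x (T x)) = 0 \<and> 0 \<le> Re (cinner x (T x)))}"

lift_definition rank_one :: "'a \<Rightarrow> 'a \<Rightarrow> 'a::complex_hilbert_space \<Rightarrow>\<^sub>L 'a"
  is "\<lambda>a b x. cinner b x *\<^sub>C a"
proof -
  fix a b :: 'a
  show "bounded_linear (\<lambda>x. cinner b x *\<^sub>C a)"
  proof (rule bounded_linear_intro)
    show "norm (cinner b x *\<^sub>C a) \<le> norm x * (norm b * norm a)" for x
      using mult_right_mono[OF norm_cinner_le[of b x] norm_ge_zero[of a]]
      by (simp add: norm_scaleC ac_simps)
  qed (simp_all add: cinner_add_right scaleC_add_left cinner_scaleC_right scaleR_scaleC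
        scaleC_scaleC)
qed

text \<open>The unique positive square root of a positive operator.\<close>

definition op_sqrt :: "('a \<Rightarrow>\<^sub>L 'a) \<Rightarrow> ('a::complex_hilbert_space \<Rightarrow>\<^sub>L 'a)" where
  "op_sqrt R = (THE S. S \<in> positive_ops \<and> S o\<^sub>L S = R)"

definition op_supp :: "('a::complex_hilbert_space \<Rightarrow>\<^sub>L 'a) \<Rightarrow> 'a set" where
  "op_supp R = closure (range (blinfun_apply R))"

section \<open>Residual-weighted iterations\<close>

definition rw_update ::
    "'a \<Rightarrow> ('a \<Rightarrow>\<^sub>L 'a) \<Rightarrow> ('a::complex_hilbert_space \<Rightarrow>\<^sub>L 'a)" where
  "rw_update u R = op_sqrt R o\<^sub>L (id_blinfun - rank_one u u) o\<^sub>L op_sqrt R"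

definition rw_iteration ::
    "(nat \<Rightarrow> 'a \<Rightarrow>\<^sub>L 'a) \<Rightarrow> (nat \<Rightarrow> 'a::complex_hilbert_space) \<Rightarrow> bool" where
  "rw_iteration R u \<longleftrightarrow>
     R 0 \<in> positive_ops \<and> (\<forall>n. norm (u n) = 1 \<and> R (Suc n) = rw_update (u n) (R n))"

definition rw_residual ::
    "(nat \<Rightarrow> 'a \<Rightarrow>\<^sub>L 'a) \<Rightarrow> (nat \<Rightarrow> 'a) \<Rightarrow> nat \<Rightarrow> 'a::complex_hilbert_space" where
  "rw_residual R u n = op_sqrt (R n) (u n)"

section \<open>Moore-Penrose inverse and its quadratic form\<close>

text \<open>
  The Moore-Penrose inverse \<open>R\<^sup>\<dagger>\<close> is in general an unbounded operator. Its domain is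
  \<open>ran R + ker R\<close>, and \<open>mp_inv R\<close> is only meaningful there: it sends
  \<open>R x + z\<close>, with \<open>x\<close> in the support and \<open>z\<close> in the kernel of \<open>R\<close>,
  to \<open>x\<close>.
\<close>

definition mp_dom :: "('a::complex_hilbert_space \<Rightarrow>\<^sub>L 'a) \<Rightarrow> 'a set" where
  "mp_dom R = {R x + z | x z. x \<in> op_supp R \<and> R z = 0}"

definition mp_inv :: "('a \<Rightarrow>\<^sub>L 'a) \<Rightarrow> 'a \<Rightarrow> 'a::complex_hilbert_space" where
  "mp_inv R y = (THE x. x \<in> op_supp R \<and> (\<exists>z. R z = 0 \<and> y = R x + z))"

text \<open>
  A vector in the range of \<open>R\<^sup>1\<^sup>/\<^sup>2\<close> need not lie in the domain of \<open>R\<^sup>\<dagger>\<close> if the range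
  of \<open>R\<close> is not closed. As usual for a positive self-adjoint operator, \<open>\<langle>E, R\<^sup>\<dagger> E\<rangle>\<close> is
  therefore read as the closed quadratic form of \<open>R\<^sup>\<dagger>\<close>, that is, the closure of the form
  \<open>x \<mapsto> \<langle>x, R\<^sup>\<dagger> x\<rangle>\<close> on the domain of \<open>R\<^sup>\<dagger>\<close>: the limit of
  \<open>\<langle>X k, R\<^sup>\<dagger> X k\<rangle>\<close> along any sequence in the domain that converges to \<open>E\<close> and is
  Cauchy for the form. By \<open>mp_form_limit_unique\<close> and \<open>mp_form_eq\<close> below the value does not
  depend on the sequence, and on the domain of \<open>R\<^sup>\<dagger>\<close> it is the literal \<open>\<langle>E, R\<^sup>\<dagger> E\<rangle>\<close>.
\<close>

definition mp_form_limit :: "('a::complex_hilbert_space \<Rightarrow>\<^sub>L 'a) \<Rightarrow> 'a \<Rightarrow> complex \<Rightarrow> bool" where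
  "mp_form_limit R E c \<longleftrightarrow>
     (\<exists>X. (\<forall>k. X k \<in> mp_dom R) \<and> X \<longlonglongrightarrow> E \<and>
          (\<forall>e>0. \<exists>N. \<forall>k\<ge>N. \<forall>l\<ge>N. cmod (cinner (X k - X l) (mp_inv R (X k - X l))) < e) \<and>
          (\<lambda>k. cinner (X k) (mp_inv R (X k))) \<longlonglongrightarrow> c)"

definition mp_form :: "('a::complex_hilbert_space \<Rightarrow>\<^sub>L 'a) \<Rightarrow> 'a \<Rightarrow> complex" where
  "mp_form R E = (THE c. mp_form_limit R E c)"

lemma positive_op_selfadjoint:
  assumes "R \<in> positive_ops"
  shows "cinner x (R y) = cinner (R x) y"
proof -
  have lin: "R (c *\<^sub>C v) = c *\<^sub>C R v" for c v
    using assms by (simp add: positive_ops_def complex_linear_def)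
  have im: "Im (cinner v (R v)) = 0" for v
    using assms by (simp add: positive_ops_def)
  have "Im (cinner x (R y) + cinner y (R x)) = 0"
    using im[of "x + y"] im[of x] im[of y]
    by (simp add: blinfun.add_right cinner_add_right cinner_add_left)
  moreover have "Re (cinner x (R y) - cinner y (R x)) = 0"
    using im[of "x + \<i> *\<^sub>C y"] im[of x] im[of y]
    by (simp add: blinfun.add_right cinner_add_right cinner_add_left lin cinner_scaleC_left
        cinner_scaleC_right)
  ultimately have "cinner x (R y) = cnj (cinner y (R x))"
    by (simp add: complex_eq_iff)
  then show ?thesis
    by (simp flip: cinner_commute)
qed

lemma positive_op_inner:
  assumes "R \<in> positive_ops"
  shows "inner x (R y) = inner (R x) y" "0 \<le> inner x (R x)"
    "cinner x (R x) = of_real (inner x (R x))"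
  using positive_op_selfadjoint[OF assms, of x y] assms
  by (auto simp: inner_eq_Re_cinner positive_ops_def complex_eq_iff)

lemma subspace_closure_normed:
  fixes S :: "'a::real_normed_vector set"
  assumes S: "subspace S"
  shows "subspace (closure S)"
proof (rule subspaceI)
  show "0 \<in> closure S"
    by (rule subsetD[OF closure_subset subspace_0[OF S]])
next
  fix x y assume "x \<in> closure S" "y \<in> closure S"
  then obtain f g where fg: "\<forall>n. f n \<in> S" "f \<longlonglongrightarrow> x" "\<forall>n. g n \<in> S" "g \<longlonglongrightarrow> y"
    unfolding closure_sequential by blast
  then have "\<forall>n. f n + g n \<in> S" "(\<lambda>n. f n + g n) \<longlonglongrightarrow> x + y"
    using subspace_add[OF S] by (auto intro: tendsto_add)
  then show "x + y \<in> closure S"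
    unfolding closure_sequential by (intro exI[of _ "\<lambda>n. f n + g n"] conjI)
next
  fix c x assume "x \<in> closure S"
  then obtain f where f: "\<forall>n. f n \<in> S" "f \<longlonglongrightarrow> x"
    unfolding closure_sequential by blast
  then have "\<forall>n. c *\<^sub>R f n \<in> S" "(\<lambda>n. c *\<^sub>R f n) \<longlonglongrightarrow> c *\<^sub>R x"
    using subspace_scale[OF S] by (auto intro: tendsto_scaleR)
  then show "c *\<^sub>R x \<in> closure S"
    unfolding closure_sequential by (intro exI[of _ "\<lambda>n. c *\<^sub>R f n"] conjI)
qed

lemma op_supp_subspace: "subspace (op_supp R)"
proof -
  have "linear (blinfun_apply R)"
    by (simp add: blinfun.bounded_linear_right bounded_linear.linear)
  then show ?thesis
    unfolding op_supp_def
    by (intro subspace_closure_normed linear_subspace_image subspace_UNIV)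
qed

lemma op_supp_orthogonal_ker:
  assumes "R \<in> positive_ops" "x \<in> op_supp R" "R z = 0"
  shows "cinner x z = 0"
proof -
  have "inner x z = 0" if "x \<in> op_supp R" "R z = 0" for x z
  proof -
    have "closed {x. inner x z = 0}"
      by (intro closed_Collect_eq continuous_intros)
    moreover have "range (blinfun_apply R) \<subseteq> {x. inner x z = 0}"
      using positive_op_inner(1)[OF assms(1)] that(2) by (auto simp: inner_commute) 
    ultimately show ?thesis
      using closure_minimal that(1) unfolding op_supp_def by blast
  qed
  note * = this
  have "R (\<i> *\<^sub>C z) = 0"
    using assms(1,3) scaleC_add_right[of \<i> "0::'a" 0]
    by (simp add: positive_ops_def complex_linear_def)
  from *[OF assms(2) this] *[OF assms(2,3)] show ?thesis
    by (simp add: inner_eq_Re_cinner cinner_scaleC_right complex_eq_iff)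
qed

lemma mp_inv_eq:
  assumes R: "R \<in> positive_ops" and x: "x \<in> op_supp R" and z: "R z = 0"
  shows "mp_inv R (R x + z) = x"
  unfolding mp_inv_def
proof (rule the_equality)
  show "x \<in> op_supp R \<and> (\<exists>z'. R z' = 0 \<and> R x + z = R x + z')"
    using x z by blast
next
  fix x' assume "x' \<in> op_supp R \<and> (\<exists>z'. R z' = 0 \<and> R x + z = R x' + z')"
  then obtain z' where x': "x' \<in> op_supp R" and z': "R z' = 0" "R x + z = R x' + z'"
    by blast
  define w where "w = x' - x"
  have w: "w \<in> op_supp R"
    unfolding w_def by (rule subspace_diff[OF op_supp_subspace x' x])
  have Rw: "R w = z - z'"
    using z'(2) by (simp add: w_def blinfun.diff_right algebra_simps)
  have "R (R w) = 0"
    using z z'(1) by (simp add: Rw blinfun.diff_right)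
  then have "inner (R w) (R w) = 0"
    using positive_op_inner(1)[OF R, of w "R w"] by simp
  then have "R w = 0"
    by simp
  from op_supp_orthogonal_ker[OF R w this] show "x' = x"
    by (simp add: cinner_self w_def)
qed

lemma mp_dom_cases:
  assumes "R \<in> positive_ops" "y \<in> mp_dom R"
  obtains z where "mp_inv R y \<in> op_supp R" "R z = 0" "y = R (mp_inv R y) + z"
proof -
  obtain x z where *: "x \<in> op_supp R" "R z = 0" "y = R x + z"
    using assms(2) by (auto simp: mp_dom_def)
  then have "mp_inv R y = x"
    using mp_inv_eq[OF assms(1)] by simp
  with * that[of z] show ?thesis
    by simp
qed

lemma mp_dom_diff:
  assumes R: "R \<in> positive_ops" and y: "y \<in> mp_dom R" and y': "y' \<in> mp_dom R"
  shows "y - y' \<in> mp_dom R" "mp_inv R (y - y') = mp_inv R y - mp_inv R y'"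
proof -
  from mp_dom_cases[OF R y] obtain z
    where *: "mp_inv R y \<in> op_supp R" "R z = 0" "y = R (mp_inv R y) + z" .
  from mp_dom_cases[OF R y'] obtain z'
    where *: "mp_inv R y' \<in> op_supp R" "R z' = 0" "y' = R (mp_inv R y') + z'"
    "mp_inv R y \<in> op_supp R" "R z = 0" "y = R (mp_inv R y) + z" using * by blast
  have s: "mp_inv R y - mp_inv R y' \<in> op_supp R"
    using * by (intro subspace_diff[OF op_supp_subspace])
  have k: "R (z - z') = 0"
    using * by (simp add: blinfun.diff_right)
  have "R (mp_inv R y) + z - (R (mp_inv R y') + z') = R (mp_inv R y - mp_inv R y') + (z - z')"
    by (simp add: blinfun.diff_right)
  then have e: "y - y' = R (mp_inv R y - mp_inv R y') + (z - z')"
    using * by metis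
  show "y - y' \<in> mp_dom R"
    unfolding mp_dom_def using e s k by blast
  show "mp_inv R (y - y') = mp_inv R y - mp_inv R y'"
    using mp_inv_eq[OF R s k] e by simp
qed

lemma mp_dom_cinner:
  assumes R: "R \<in> positive_ops" and y: "y \<in> mp_dom R" and x: "x \<in> op_supp R"
  shows "cinner x y = cinner x (R (mp_inv R y))" "cinner y x = cinner (R (mp_inv R y)) x"
proof -
  from mp_dom_cases[OF R y] obtain z
    where *: "mp_inv R y \<in> op_supp R" "R z = 0" "y = R (mp_inv R y) + z" .
  have "cinner x y = cinner x (R (mp_inv R y) + z)"
    using *(3) by simp
  then show "cinner x y = cinner x (R (mp_inv R y))"
    using op_supp_orthogonal_ker[OF R x *(2)] by (simp add: cinner_add_right)
  then show "cinner y x = cinner (R (mp_inv R y)) x"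
    by (metis cinner_commute)
qed

lemma mp_dom_form:
  assumes R: "R \<in> positive_ops" and y: "y \<in> mp_dom R"
  shows "cinner y (mp_inv R y) = of_real (inner (mp_inv R y) (R (mp_inv R y)))"
proof -
  have "mp_inv R y \<in> op_supp R"
    using mp_dom_cases[OF R y] by blast
  from mp_dom_cinner(2)[OF R y this] show ?thesis
    by (simp flip: positive_op_selfadjoint[OF R] positive_op_inner(3)[OF R])
qed

text \<open>Cauchy-Schwarz and the triangle inequality for the seminorm \<open>a \<mapsto> \<langle>a, R a\<rangle>\<^sup>1\<^sup>/\<^sup>2\<close>.\<close>

lemma positive_op_cauchy_schwarz:
  assumes R: "R \<in> positive_ops"
  shows "\<bar>inner a (R b)\<bar> \<le> sqrt (inner a (R a)) * sqrt (inner b (R b))"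
proof -
  have expand: "inner (a + t *\<^sub>R b) (R (a + t *\<^sub>R b))
      = inner a (R a) + 2 * t * inner a (R b) + t\<^sup>2 * inner b (R b)" for t
    using positive_op_inner(1)[OF R, of b a]
    by (simp add: blinfun.add_right blinfun.scaleR_right inner_add_left inner_add_right
        power2_eq_square algebra_simps inner_commute)
  have nonneg: "0 \<le> inner b (R b) * t\<^sup>2 + (2 * inner a (R b)) * t + inner a (R a)" for t
    using positive_op_inner(2)[OF R, of "a + t *\<^sub>R b"] unfolding expand by (simp add: algebra_simps)
  have "(inner a (R b))\<^sup>2 \<le> inner a (R a) * inner b (R b)"
  proof (cases "inner b (R b) = 0")
    case True
    have "inner a (R b) = 0"
    proof (rule ccontr)
      assume "inner a (R b) \<noteq> 0"
      with nonneg[of "- (inner a (R a) + 1) / (2 * inner a (R b))"] True show False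
        by simp
    qed
    with True show ?thesis by simp
  next
    case False
    then have pos: "0 < inner b (R b)"
      using positive_op_inner(2)[OF R, of b] by simp
    have "0 \<le> inner b (R b) * (- inner a (R b) / inner b (R b))\<^sup>2
      + (2 * inner a (R b)) * (- inner a (R b) / inner b (R b)) + inner a (R a)"
      by (rule nonneg)
    also have "\<dots> = inner a (R a) - (inner a (R b))\<^sup>2 / inner b (R b)"
      using pos by (simp add: field_simps power2_eq_square)
    finally show ?thesis
      using pos by (simp add: field_simps)
  qed
  then have "sqrt ((inner a (R b))\<^sup>2) \<le> sqrt (inner a (R a) * inner b (R b))"
    by (rule real_sqrt_le_mono)
  then show ?thesis
    by (simp add: real_sqrt_mult)
qed

lemma positive_op_triangle:
  assumes R: "R \<in> positive_ops"
  shows "sqrt (inner (a - b) (R (a - b))) \<le> sqrt (inner a (R a)) + sqrt (inner b (R b))"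
proof -
  have "inner (a - b) (R (a - b)) = inner a (R a) - 2 * inner a (R b) + inner b (R b)"
    using positive_op_inner(1)[OF R, of b a]
    by (simp add: blinfun.diff_right inner_diff_left inner_diff_right algebra_simps inner_commute)
  also have "\<dots> \<le> inner a (R a) + 2 * (sqrt (inner a (R a)) * sqrt (inner b (R b))) + inner b (R b)"
    using positive_op_cauchy_schwarz[OF R, of a b] by linarith
  also have "\<dots> = (sqrt (inner a (R a)) + sqrt (inner b (R b)))\<^sup>2"
    using positive_op_inner(2)[OF R] by (simp add: power2_sum)
  finally have "sqrt (inner (a - b) (R (a - b)))
      \<le> sqrt ((sqrt (inner a (R a)) + sqrt (inner b (R b)))\<^sup>2)"
    by (rule real_sqrt_le_mono)
  then show ?thesis
    using positive_op_inner(2)[OF R] by simp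
qed

lemma mp_form_limit_unique:
  assumes R: "R \<in> positive_ops" and c: "mp_form_limit R E c" and d: "mp_form_limit R E d"
  shows "c = d"
proof -
  define p where "p a = sqrt (inner a (R a))" for a
  have p2: "(p a)\<^sup>2 = inner a (R a)" and p0: "0 \<le> p a" for a
    using positive_op_inner(2)[OF R] by (simp_all add: p_def)
  have p_diff: "p (a - b) \<le> p a + p b" for a b
    unfolding p_def by (rule positive_op_triangle[OF R])
  have p_neg: "p (a - b) = p (b - a)" for a b
    by (simp add: p_def blinfun.diff_right inner_diff_left inner_diff_right)
  have p_tri: "p (a + b) \<le> p a + p b" for a b
    using p_diff[of a "- b"] by (simp add: p_def blinfun.minus_right)
  have form: "cinner y (mp_inv R y) = of_real ((p (mp_inv R y))\<^sup>2)" if "y \<in> mp_dom R" for y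
    using mp_dom_form[OF R that] by (simp add: p2)

  have *: "\<exists>X. (\<forall>k. X k \<in> mp_dom R) \<and> X \<longlonglongrightarrow> E \<and>
      (\<forall>e>0. \<exists>N. \<forall>k\<ge>N. \<forall>l\<ge>N. p (mp_inv R (X k) - mp_inv R (X l)) < e) \<and>
      (\<lambda>k. complex_of_real ((p (mp_inv R (X k)))\<^sup>2)) \<longlonglongrightarrow> c" if lc: "mp_form_limit R E c" for c
  proof -
    obtain X where X: "\<And>k. X k \<in> mp_dom R" "X \<longlonglongrightarrow> E"
      and cau: "\<And>e. e > 0 \<Longrightarrow>
        \<exists>N. \<forall>k\<ge>N. \<forall>l\<ge>N. cmod (cinner (X k - X l) (mp_inv R (X k - X l))) < e"
      and lim: "(\<lambda>k. cinner (X k) (mp_inv R (X k))) \<longlonglongrightarrow> c"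
      using lc unfolding mp_form_limit_def by blast
    have eq: "cmod (cinner (X k - X l) (mp_inv R (X k - X l)))
        = (p (mp_inv R (X k) - mp_inv R (X l)))\<^sup>2" for k l
      using form[OF mp_dom_diff(1)[OF R X(1)[of k] X(1)[of l]]]
        mp_dom_diff(2)[OF R X(1)[of k] X(1)[of l]]
      by (simp add: norm_power p0)
    have "\<exists>N. \<forall>k\<ge>N. \<forall>l\<ge>N. p (mp_inv R (X k) - mp_inv R (X l)) < e" if e: "e > 0" for e
    proof -
      obtain N where "\<forall>k\<ge>N. \<forall>l\<ge>N. (p (mp_inv R (X k) - mp_inv R (X l)))\<^sup>2 < e\<^sup>2"
        using cau[of "e\<^sup>2"] e unfolding eq by fastforce
      then show ?thesis
        using power2_less_imp_less e by (meson less_imp_le)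
    qed
    then show ?thesis
      using X lim form by (intro exI[of _ X]) simp
  qed
  obtain X where X: "\<And>k. X k \<in> mp_dom R" "X \<longlonglongrightarrow> E"
    and Xc: "\<And>e. e > 0 \<Longrightarrow> \<exists>N. \<forall>k\<ge>N. \<forall>l\<ge>N. p (mp_inv R (X k) - mp_inv R (X l)) < e"
    and Xl: "(\<lambda>k. complex_of_real ((p (mp_inv R (X k)))\<^sup>2)) \<longlonglongrightarrow> c"
    using *[OF c] by blast
  obtain Y where Y: "\<And>k. Y k \<in> mp_dom R" "Y \<longlonglongrightarrow> E"
    and Yc: "\<And>e. e > 0 \<Longrightarrow> \<exists>N. \<forall>k\<ge>N. \<forall>l\<ge>N. p (mp_inv R (Y k) - mp_inv R (Y l)) < e"
    and Yl: "(\<lambda>k. complex_of_real ((p (mp_inv R (Y k)))\<^sup>2)) \<longlonglongrightarrow> d"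
    using *[OF d] by blast
  have conv: "(\<lambda>k. p (a k)) \<longlonglongrightarrow> sqrt (Re c)"
    if "(\<lambda>k. complex_of_real ((p (a k))\<^sup>2)) \<longlonglongrightarrow> c" for a c
    using tendsto_real_sqrt[OF tendsto_Re[OF that]] p0 by simp
  define D where "D k = X k - Y k" for k
  define \<delta> where "\<delta> k = mp_inv R (X k) - mp_inv R (Y k)" for k
  have D: "D k \<in> mp_dom R" "mp_inv R (D k) = \<delta> k" for k
    using mp_dom_diff[OF R X(1) Y(1)] by (simp_all add: D_def \<delta>_def)
  have \<delta>_supp: "\<delta> k \<in> op_supp R" for k
    using mp_dom_cases[OF R D(1)[of k]] D(2) by metis
  have D0: "D \<longlonglongrightarrow> 0"
    using tendsto_diff[OF X(2) Y(2)] by (simp add: D_def[abs_def])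
  have \<delta>c: "\<exists>N. \<forall>k\<ge>N. \<forall>l\<ge>N. p (\<delta> k - \<delta> l) < e" if e: "e > 0" for e
  proof -
    obtain N M where N: "\<forall>k\<ge>N. \<forall>l\<ge>N. p (mp_inv R (X k) - mp_inv R (X l)) < e / 2"
      and M: "\<forall>k\<ge>M. \<forall>l\<ge>M. p (mp_inv R (Y k) - mp_inv R (Y l)) < e / 2"
      using Xc[of "e / 2"] Yc[of "e / 2"] e by (meson half_gt_zero)
    have "p (\<delta> k - \<delta> l) < e" if "k \<ge> max N M" "l \<ge> max N M" for k l
    proof -
      have "\<delta> k - \<delta> l = (mp_inv R (X k) - mp_inv R (X l)) - (mp_inv R (Y k) - mp_inv R (Y l))"
        by (simp add: \<delta>_def)
      then have "p (\<delta> k - \<delta> l)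
          \<le> p (mp_inv R (X k) - mp_inv R (X l)) + p (mp_inv R (Y k) - mp_inv R (Y l))"
        using p_diff by metis
      moreover have "p (mp_inv R (X k) - mp_inv R (X l)) < e / 2"
        using N that by simp
      moreover have "p (mp_inv R (Y k) - mp_inv R (Y l)) < e / 2"
        using M that by simp
      ultimately show ?thesis by linarith
    qed
    then show ?thesis by blast
  qed
  obtain B where B: "\<And>k. p (\<delta> k) \<le> B" "B > 0"
  proof -
    have "Bseq (\<lambda>k. p (mp_inv R (X k)) + p (mp_inv R (Y k)))"
      using tendsto_add[OF conv[OF Xl] conv[OF Yl]]
      by (intro convergent_imp_Bseq) (auto simp: convergent_def)
    then obtain K where K: "K > 0" "\<And>k. \<bar>p (mp_inv R (X k)) + p (mp_inv R (Y k))\<bar> \<le> K"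
      unfolding Bseq_def by auto
    have "p (\<delta> k) \<le> K" for k
      using p_diff[of "mp_inv R (X k)" "mp_inv R (Y k)"] K(2)[of k] by (simp add: \<delta>_def)
    with that K(1) show ?thesis by blast
  qed
  have step: "(p (\<delta> k))\<^sup>2 \<le> B * p (\<delta> k - \<delta> l) + norm (\<delta> k) * norm (D l)" for k l
  proof -
    have "inner (\<delta> k) (R (\<delta> l)) = inner (\<delta> k) (D l)"
      using mp_dom_cinner(1)[OF R D(1)[of l] \<delta>_supp[of k]] D(2)
      by (simp add: inner_eq_Re_cinner)
    then have "(p (\<delta> k))\<^sup>2 = inner (\<delta> k) (R (\<delta> k - \<delta> l)) + inner (\<delta> k) (D l)"
      by (simp add: p2 blinfun.diff_right inner_diff_right)
    moreover have "inner (\<delta> k) (R (\<delta> k - \<delta> l)) \<le> p (\<delta> k) * p (\<delta> k - \<delta> l)"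
      using positive_op_cauchy_schwarz[OF R, of "\<delta> k" "\<delta> k - \<delta> l"] by (simp add: p_def)
    moreover have "p (\<delta> k) * p (\<delta> k - \<delta> l) \<le> B * p (\<delta> k - \<delta> l)"
      by (rule mult_right_mono[OF B(1) p0])
    moreover have "inner (\<delta> k) (D l) \<le> norm (\<delta> k) * norm (D l)"
      by (rule norm_cauchy_schwarz)
    ultimately show ?thesis by linarith
  qed
  have "(\<lambda>k. (p (\<delta> k))\<^sup>2) \<longlonglongrightarrow> 0"
  proof (rule LIMSEQ_I)
    fix e :: real assume e: "e > 0"
    then obtain N where N: "\<And>k l. k \<ge> N \<Longrightarrow> l \<ge> N \<Longrightarrow> p (\<delta> k - \<delta> l) < e / (2 * B)"
      using \<delta>c[of "e / (2 * B)"] B(2) by auto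
    have "(p (\<delta> k))\<^sup>2 < e" if k: "k \<ge> N" for k
    proof -
      have lim: "(\<lambda>l. e / 2 + norm (\<delta> k) * norm (D l)) \<longlonglongrightarrow> e / 2 + norm (\<delta> k) * 0"
        by (intro tendsto_intros tendsto_norm_zero D0)
      have "(p (\<delta> k))\<^sup>2 \<le> e / 2 + norm (\<delta> k) * norm (D l)" if "l \<ge> N" for l
      proof -
        have "B * p (\<delta> k - \<delta> l) \<le> e / 2"
          using N[OF k that] B(2) by (simp add: field_simps)
        with step[of k l] show ?thesis by linarith
      qed
      then have "(p (\<delta> k))\<^sup>2 \<le> e / 2 + norm (\<delta> k) * 0"
        by (intro LIMSEQ_le_const[OF lim]) blast
      with e show ?thesis by simp
    qed
    then show "\<exists>no. \<forall>n\<ge>no. norm ((p (\<delta> n))\<^sup>2 - 0) < e"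
      by auto
  qed
  from tendsto_real_sqrt[OF this] have \<delta>0: "(\<lambda>k. p (\<delta> k)) \<longlonglongrightarrow> 0"
    using p0 by simp
  have "(\<lambda>k. p (mp_inv R (X k)) - p (mp_inv R (Y k))) \<longlonglongrightarrow> 0"
  proof (rule Lim_null_comparison[OF _ \<delta>0], rule always_eventually, rule allI)
    fix k
    have "p (mp_inv R (X k)) \<le> p (\<delta> k) + p (mp_inv R (Y k))"
      using p_tri[of "\<delta> k" "mp_inv R (Y k)"] by (simp add: \<delta>_def)
    moreover have "p (mp_inv R (Y k)) \<le> p (\<delta> k) + p (mp_inv R (X k))"
      using p_tri[of "mp_inv R (Y k) - mp_inv R (X k)" "mp_inv R (X k)"]
        p_neg[of "mp_inv R (Y k)" "mp_inv R (X k)"] by (simp add: \<delta>_def)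
    ultimately show "norm (p (mp_inv R (X k)) - p (mp_inv R (Y k))) \<le> p (\<delta> k)"
      by simp
  qed
  with tendsto_diff[OF conv[OF Xl] conv[OF Yl]] have "sqrt (Re c) - sqrt (Re d) = 0"
    by (rule LIMSEQ_unique)
  then have "Re c = Re d"
    by simp
  moreover have "Im c = 0" "Im d = 0"
    using tendsto_Im[OF Xl] tendsto_Im[OF Yl] by (simp_all add: LIMSEQ_const_iff)
  ultimately show ?thesis
    by (simp add: complex_eq_iff)
qed

lemma mp_form_eqI:
  assumes "R \<in> positive_ops" "mp_form_limit R E c"
  shows "mp_form R E = c"
  unfolding mp_form_def using mp_form_limit_unique[OF assms(1)] assms(2) by blast

lemma mp_form_eq:
  assumes R: "R \<in> positive_ops" and E: "E \<in> mp_dom R"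
  shows "mp_form R E = cinner E (mp_inv R E)"
proof (rule mp_form_eqI[OF R])
  have "mp_inv R 0 = 0"
    using mp_dom_diff(2)[OF R E E] by simp
  then show "mp_form_limit R E (cinner E (mp_inv R E))"
    unfolding mp_form_limit_def using E by (intro exI[of _ "\<lambda>_. E"]) auto
qed

end

theory Submission
  imports Defs
begin

text \<open>
  Everything rests on one computation: for \<open>R \<ge> 0\<close> and \<open>u \<in> supp R\<close>, the quadratic form of
  the Moore-Penrose inverse satisfies \<open>\<langle>R\<^sup>1\<^sup>/\<^sup>2u, R\<^sup>\<dagger> R\<^sup>1\<^sup>/\<^sup>2u\<rangle> = \<parallel>u\<parallel>\<^sup>2\<close>
  (\<open>mp_form_op_sqrt\<close>). On vectors \<open>R x\<close> with \<open>x \<in> supp R\<close> the form is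
  \<open>\<langle>R x, x\<rangle> = \<parallel>R\<^sup>1\<^sup>/\<^sup>2x\<parallel>\<^sup>2\<close>, and the vectors \<open>R\<^sup>1\<^sup>/\<^sup>2x\<close> approximate every \<open>u\<close> in the support,
  so the general case follows by passing to the limit.

  Both directions of the theorem can be read off from this. If \<open>E \<in> ran R\<^sup>1\<^sup>/\<^sup>2\<close>, the orthogonal
  projection to the support (\<open>op_supp_decomposition\<close>) gives a preimage \<open>u\<close> of \<open>E\<close> in
  \<open>supp R\<close>, and the normalization says exactly that \<open>\<parallel>u\<parallel> = 1\<close>; moreover
  \<open>R\<^sup>1\<^sup>/\<^sup>2(I - |u\<rangle>\<langle>u|)R\<^sup>1\<^sup>/\<^sup>2 = R - |E\<rangle>\<langle>E|\<close> (\<open>rw_update_eq\<close>). Conversely, a unit vector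
  in the support gives the value \<open>1\<close>, as soon as all the \<open>R\<^sub>n\<close> are known to be positive, and this
  property is inherited along the iteration by Cauchy-Schwarz (\<open>rw_update_positive\<close>).

  The positive square root is constructed without spectral theory. For a self-adjoint contraction
  \<open>T\<close>, the iteration \<open>Y \<mapsto> (T + Y\<^sup>2) / 2\<close> from \<open>0\<close> is dominated in norm, step by step,
  by the scalar iteration \<open>y \<mapsto> (1 + y\<^sup>2) / 2\<close>, so it converges in norm, and its limit satisfies
  \<open>(I - Y)\<^sup>2 = I - T\<close>. Every positive operator is a positive multiple of such an \<open>I - T\<close>.
  Since the limit commutes with whatever commutes with \<open>T\<close>, a second positive root would
  commute with it, and two commuting positive roots of the same operator are equal.
\<close>

section \<open>Positive operators\<close>

lemma bounded_linear_scaleC: "bounded_linear (\<lambda>x::'a::complex_hilbert_space. c *\<^sub>C x)"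
  by (rule bounded_linear_intro[where K = "cmod c"])
    (simp_all add: scaleC_add_right scaleR_scaleC scaleC_scaleC norm_scaleC mult.commute)

lemma Im_cinner_eq_inner: "Im (cinner x y) = inner (\<i> *\<^sub>C x) y"
  for x :: "'a::complex_hilbert_space"
  by (simp add: inner_eq_Re_cinner cinner_scaleC_left)

text \<open>
  On a complex space, a complex linear map that is symmetric for the real inner product has a real
  quadratic form: replacing \<open>x\<close> by \<open>\<i> x\<close> in the real symmetry turns the imaginary part of
  \<open>\<langle>x, T x\<rangle>\<close> into its negative. So positivity can be checked with real inner products only.
\<close>

lemma positive_opsI:
  assumes lin: "complex_linear T"
    and sym: "\<And>x y. inner x (T y) = inner (T x) y"
    and nonneg: "\<And>x. 0 \<le> inner x (T x)"
  shows "T \<in> positive_ops"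
proof -
  have "Im (cinner x (T x)) = 0" for x
  proof -
    have "Im (cinner x (T x)) = inner (T (\<i> *\<^sub>C x)) x"
      by (simp add: Im_cinner_eq_inner sym)
    also have "\<dots> = Im (cinner (T x) x)"
      using lin by (simp add: complex_linear_def Im_cinner_eq_inner)
    also have "\<dots> = - Im (cinner x (T x))"
      by (subst cinner_commute) simp
    finally show ?thesis by simp
  qed
  with lin nonneg show ?thesis
    by (simp add: positive_ops_def inner_eq_Re_cinner)
qed

text \<open>
  Cauchy-Schwarz for the seminorm \<open>\<langle>x, R x\<rangle>\<^sup>1\<^sup>/\<^sup>2\<close>, applied to \<open>R x\<close> and \<open>x\<close>.
\<close>

lemma positive_op_form_zero:
  assumes R: "R \<in> positive_ops" and x: "inner x (R x) = 0"
  shows "R x = 0"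
proof -
  have "inner (R x) (R x) \<le> 0"
    using positive_op_cauchy_schwarz[OF R, of "R x" x] x by simp
  then show ?thesis
    by (metis inner_eq_zero_iff inner_ge_zero order_antisym)
qed

text \<open>
  The norm of a positive operator is controlled by its quadratic form: by Cauchy-Schwarz for
  that form, \<open>\<parallel>T x\<parallel>\<^sup>2 \<le> \<langle>T x, T T x\<rangle>\<^sup>1\<^sup>/\<^sup>2 \<langle>x, T x\<rangle>\<^sup>1\<^sup>/\<^sup>2 \<le> \<parallel>T x\<parallel> \<parallel>x\<parallel>\<close>.
\<close>

lemma positive_contraction_norm:
  assumes T: "T \<in> positive_ops" and le: "\<And>x. inner x (T x) \<le> (norm x)\<^sup>2"
  shows "norm T \<le> 1"
proof (rule norm_blinfun_bound)
  fix x
  have sq: "sqrt (inner a (T a)) \<le> norm a" for a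
    using real_sqrt_le_mono[OF le[of a]] by simp
  have "(norm (T x))\<^sup>2 = inner (T x) (T x)"
    by (simp add: dot_square_norm)
  also have "\<dots> \<le> sqrt (inner (T x) (T (T x))) * sqrt (inner x (T x))"
    using positive_op_cauchy_schwarz[OF T, of "T x" x] by simp
  also have "\<dots> \<le> norm (T x) * norm x"
    using sq positive_op_inner(2)[OF T] by (intro mult_mono) auto
  finally show "norm (T x) \<le> 1 * norm x"
    by (cases "norm (T x) = 0") (simp_all add: power2_eq_square)
qed simp

section \<open>The positive square root\<close>

text \<open>
  A fixed point \<open>Y\<close> of this iteration satisfies \<open>(I - Y)\<^sup>2 = I - T\<close>, so \<open>I - Y\<close> is
  a square root of \<open>I - T\<close>.
\<close>

primrec sqrt_iter :: "('a::real_normed_vector \<Rightarrow>\<^sub>L 'a) \<Rightarrow> nat \<Rightarrow> 'a \<Rightarrow>\<^sub>L 'a" where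
  "sqrt_iter T 0 = 0"
| "sqrt_iter T (Suc n) = (1/2) *\<^sub>R (T + (sqrt_iter T n o\<^sub>L sqrt_iter T n))"

text \<open>
  The same iteration for the scalar \<open>1\<close> in place of \<open>T\<close>.
\<close>

primrec sqrt_majorant :: "nat \<Rightarrow> real" where
  "sqrt_majorant 0 = 0"
| "sqrt_majorant (Suc n) = (1 + (sqrt_majorant n)\<^sup>2) / 2"

lemma sqrt_majorant_bounds: "0 \<le> sqrt_majorant n" "sqrt_majorant n \<le> 1"
  by (induction n) (auto simp: power_le_one)

lemma sqrt_majorant_mono: "sqrt_majorant n \<le> sqrt_majorant (Suc n)"
proof -
  have "0 \<le> (1 - sqrt_majorant n)\<^sup>2" by simp
  then show ?thesis by (simp add: power2_eq_square algebra_simps)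
qed

lemma sqrt_iter_norm:
  assumes T: "norm T \<le> 1"
  shows "norm (sqrt_iter T n) \<le> sqrt_majorant n"
proof (induction n)
  case (Suc n)
  have "norm (sqrt_iter T n o\<^sub>L sqrt_iter T n) \<le> (sqrt_majorant n)\<^sup>2"
    unfolding power2_eq_square
    by (rule order_trans[OF norm_blinfun_compose mult_mono[OF Suc Suc]])
      (simp_all add: sqrt_majorant_bounds)
  with T have "norm (T + (sqrt_iter T n o\<^sub>L sqrt_iter T n)) \<le> 1 + (sqrt_majorant n)\<^sup>2"
    by (rule norm_triangle_mono)
  then show ?case by simp
qed simp

text \<open>
  With \<open>A\<close>, \<open>B\<close> consecutive iterates and \<open>a\<close>, \<open>b\<close> their scalar counterparts, the next increment is
  \<open>(A\<^sup>2 - B\<^sup>2) / 2 = (A (A - B) + (A - B) B) / 2\<close>. Its norm is at most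
  \<open>(a (a - b) + (a - b) b) / 2 = (a\<^sup>2 - b\<^sup>2) / 2\<close>, the next scalar increment.
\<close>

lemma sqrt_iter_increment:
  assumes T: "norm T \<le> 1"
  shows "norm (sqrt_iter T (Suc n) - sqrt_iter T n) \<le> sqrt_majorant (Suc n) - sqrt_majorant n"
proof (induction n)
  case 0
  show ?case using T by simp
next
  case (Suc n)
  let ?A = "sqrt_iter T (Suc n)" and ?B = "sqrt_iter T n"
  let ?a = "sqrt_majorant (Suc n)" and ?b = "sqrt_majorant n"
  have "sqrt_iter T (Suc (Suc n)) - ?A = (1/2) *\<^sub>R ((?A o\<^sub>L ?A) - (?B o\<^sub>L ?B))"
    using arg_cong2[of _ _ _ _ minus, OF sqrt_iter.simps(2)[of T "Suc n"] sqrt_iter.simps(2)[of T n]]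
    by (simp add: scaleR_right_diff_distrib scaleR_right_distrib del: sqrt_iter.simps)
  also have "(?A o\<^sub>L ?A) - (?B o\<^sub>L ?B) = (?A o\<^sub>L (?A - ?B)) + ((?A - ?B) o\<^sub>L ?B)"
    by (rule blinfun_eqI) (simp add: blinfun.diff_left blinfun.add_left blinfun.diff_right
        del: sqrt_iter.simps)
  finally have "norm (sqrt_iter T (Suc (Suc n)) - ?A)
      = norm ((?A o\<^sub>L (?A - ?B)) + ((?A - ?B) o\<^sub>L ?B)) / 2"
    by (simp del: sqrt_iter.simps)
  also have "\<dots> \<le> (?a * (?a - ?b) + (?a - ?b) * ?b) / 2"
  proof -
    have "norm (?A o\<^sub>L (?A - ?B)) \<le> ?a * (?a - ?b)"
      by (rule order_trans[OF norm_blinfun_compose mult_mono])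
        (use Suc sqrt_iter_norm[OF T] sqrt_majorant_bounds(1) in \<open>simp_all del: sqrt_iter.simps sqrt_majorant.simps\<close>)
    moreover have "norm ((?A - ?B) o\<^sub>L ?B) \<le> (?a - ?b) * ?b"
      by (rule order_trans[OF norm_blinfun_compose mult_mono])
        (use Suc sqrt_iter_norm[OF T] sqrt_majorant_mono in \<open>simp_all del: sqrt_iter.simps sqrt_majorant.simps\<close>)
    ultimately show ?thesis
      by (intro divide_right_mono norm_triangle_mono) auto
  qed
  also have "\<dots> = sqrt_majorant (Suc (Suc n)) - ?a"
    by (simp only: sqrt_majorant.simps(2)[of "Suc n"] sqrt_majorant.simps(2)[of n])
      (simp add: power2_eq_square field_simps)
  finally show ?case .
qed

text \<open>
  The scalar iteration increases and is bounded by \<open>1\<close>, so its increments are summable, and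
  they dominate the increments of \<open>sqrt_iter T\<close>.
\<close>

lemma sqrt_iter_convergent:
  fixes T :: "'a::banach \<Rightarrow>\<^sub>L 'a"
  assumes T: "norm T \<le> 1"
  shows "convergent (sqrt_iter T)"
proof -
  have "incseq sqrt_majorant"
    by (rule incseq_SucI) (rule sqrt_majorant_mono)
  then obtain l where "sqrt_majorant \<longlonglongrightarrow> l"
    by (rule incseq_convergent) (use sqrt_majorant_bounds(2) in blast)
  then have "summable (\<lambda>n. sqrt_majorant (Suc n) - sqrt_majorant n)"
    by (rule telescope_summable)
  then have "summable (\<lambda>n. sqrt_iter T (Suc n) - sqrt_iter T n)"
    by (rule summable_comparison_test'[where N = 0])
      (use sqrt_iter_increment[OF T] in auto)
  from summable_LIMSEQ[OF this] have "convergent (\<lambda>n. sqrt_iter T n - sqrt_iter T 0)"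
    unfolding convergent_def sum_lessThan_telescope by blast
  then show ?thesis by simp
qed

text \<open>
  The commutant is taken among all bounded real-linear maps. It then contains the
  multiplications by complex scalars, and complex linearity passes from \<open>T\<close> to \<open>S\<close>.
\<close>

definition in_bicommutant ::
    "('a::real_normed_vector \<Rightarrow>\<^sub>L 'a) \<Rightarrow> ('a \<Rightarrow>\<^sub>L 'a) \<Rightarrow> bool" where
  "in_bicommutant S T \<longleftrightarrow>
     (\<forall>f. bounded_linear f \<longrightarrow> (\<forall>x. f (T x) = T (f x)) \<longrightarrow> (\<forall>x. f (S x) = S (f x)))"

lemma in_bicommutantI:
  fixes S T :: "'a::real_normed_vector \<Rightarrow>\<^sub>L 'a"
  assumes "\<And>f x. bounded_linear f \<Longrightarrow> (\<And>x. f (T x) = T (f x)) \<Longrightarrow> f (S x) = S (f x)"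
  shows "in_bicommutant S T"
  unfolding in_bicommutant_def by (intro allI impI) (rule assms; simp)

lemma in_bicommutantD:
  assumes "in_bicommutant S T" "bounded_linear f" "\<And>x. f (T x) = T (f x)"
  shows "f (S x) = S (f x)"
  using assms(1)[unfolded in_bicommutant_def, rule_format, OF assms(2,3)] .

lemma in_bicommutant_complex_linear:
  assumes "in_bicommutant S T" "complex_linear T"
  shows "complex_linear S"
  unfolding complex_linear_def
proof (intro allI)
  fix c x
  show "S (c *\<^sub>C x) = c *\<^sub>C S x"
    by (rule in_bicommutantD[OF assms(1) bounded_linear_scaleC, symmetric])
      (use assms(2) in \<open>simp add: complex_linear_def\<close>)
qed

lemma sqrt_iter_commute:
  fixes T :: "'a::real_normed_vector \<Rightarrow>\<^sub>L 'a"
  assumes f: "bounded_linear f" and comm: "\<And>x. f (T x) = T (f x)"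
  shows "f (sqrt_iter T n x) = sqrt_iter T n (f x)"
proof (induction n arbitrary: x)
  case 0
  show ?case using linear_0[OF bounded_linear.linear[OF f]] by simp
next
  case (Suc n)
  then show ?case
    by (simp add: blinfun.scaleR_left blinfun.add_left comm
        linear_cmul[OF bounded_linear.linear[OF f]] linear_add[OF bounded_linear.linear[OF f]])
qed

lemma sqrt_iter_symmetric:
  fixes T :: "'a::real_inner \<Rightarrow>\<^sub>L 'a"
  assumes sym: "\<And>x y. inner x (T y) = inner (T x) y"
  shows "inner x (sqrt_iter T n y) = inner (sqrt_iter T n x) y"
  by (induction n arbitrary: x y)
    (simp_all add: blinfun.scaleR_left blinfun.add_left inner_add_left inner_add_right sym)

text \<open>
  The root is \<open>I - Y\<close> for the limit \<open>Y\<close> of the iteration. It is nonnegative because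
  \<open>\<parallel>Y\<parallel> \<le> 1\<close>; symmetry and membership in the bicommutant hold for every iterate and pass to
  the limit.
\<close>

lemma contraction_sqrt_complement:
  fixes T :: "'a::{real_inner,banach} \<Rightarrow>\<^sub>L 'a"
  assumes T: "norm T \<le> 1" and sym: "\<And>x y. inner x (T y) = inner (T x) y"
  obtains S where "S o\<^sub>L S = id_blinfun - T" "\<And>x y. inner x (S y) = inner (S x) y"
    "\<And>x. 0 \<le> inner x (S x)"
    "in_bicommutant S T"
proof -
  obtain Y where Y: "sqrt_iter T \<longlonglongrightarrow> Y"
    using sqrt_iter_convergent[OF T] unfolding convergent_def by blast
  have Yx: "(\<lambda>n. sqrt_iter T n x) \<longlonglongrightarrow> Y x" for x
    by (intro blinfun.tendsto Y tendsto_const)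
  have "(\<lambda>n. sqrt_iter T (Suc n)) \<longlonglongrightarrow> (1/2) *\<^sub>R (T + (Y o\<^sub>L Y))"
    unfolding sqrt_iter.simps
    by (intro tendsto_intros bounded_bilinear.tendsto[OF bounded_bilinear_blinfun_compose] Y)
  from LIMSEQ_unique[OF LIMSEQ_Suc[OF Y] this]
  have fixpoint: "Y = (1/2) *\<^sub>R (T + (Y o\<^sub>L Y))" .
  have Y_sym: "inner x (Y y) = inner (Y x) y" for x y
    by (rule LIMSEQ_unique[OF tendsto_inner[OF tendsto_const Yx]])
      (simp add: sqrt_iter_symmetric[OF sym] tendsto_inner[OF Yx tendsto_const])
  have "norm Y \<le> 1"
    by (rule LIMSEQ_le_const2[OF tendsto_norm[OF Y]])
      (use order_trans[OF sqrt_iter_norm[OF T] sqrt_majorant_bounds(2)] in blast)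
  then have Y_norm: "norm (Y x) \<le> norm x" for x
    using norm_blinfun[of Y x] mult_right_mono[of "norm Y" 1 "norm x"] by simp
  let ?S = "id_blinfun - Y"
  show thesis
  proof (rule that[of ?S])
    have "2 *\<^sub>R Y = T + (Y o\<^sub>L Y)"
      using arg_cong[OF fixpoint, of "\<lambda>Z. 2 *\<^sub>R Z"] by simp
    then have "(2 *\<^sub>R Y) x = (T + (Y o\<^sub>L Y)) x" for x
      by (rule arg_cong)
    then have "Y x + Y x = T x + Y (Y x)" for x
      by (simp add: blinfun.add_left blinfun.scaleR_left scaleR_2)
    then show "?S o\<^sub>L ?S = id_blinfun - T"
      by (intro blinfun_eqI) (simp add: blinfun.diff_left blinfun.diff_right algebra_simps)
    show "inner x (?S y) = inner (?S x) y" for x y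
      by (simp add: blinfun.diff_left inner_diff_left inner_diff_right Y_sym)
    show "0 \<le> inner x (?S x)" for x
      using norm_cauchy_schwarz[of x "Y x"] mult_left_mono[OF Y_norm[of x] norm_ge_zero[of x]]
      by (simp add: blinfun.diff_left inner_diff_right dot_square_norm power2_eq_square)
    show "in_bicommutant ?S T"
    proof (rule in_bicommutantI)
      fix f x
      assume f: "bounded_linear f" and comm: "\<And>x. f (T x) = T (f x)"
      have "f (Y x) = Y (f x)"
        by (rule LIMSEQ_unique[OF bounded_linear.tendsto[OF f Yx]])
          (simp add: sqrt_iter_commute[OF f comm] Yx)
      then show "f (?S x) = ?S (f x)"
        by (simp add: blinfun.diff_left linear_diff[OF bounded_linear.linear[OF f]])
    qed
  qed
qed

text \<open>
  Scaling: for \<open>c > \<parallel>R\<parallel>\<close>, the operator \<open>T = I - R / c\<close> satisfies \<open>0 \<le> T \<le> I\<close>,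
  and \<open>R = c (I - T)\<close>.
\<close>

lemma positive_sqrt_exists:
  assumes R: "R \<in> positive_ops"
  obtains S where "S \<in> positive_ops" "S o\<^sub>L S = R"
    "in_bicommutant S R"
proof -
  \<comment> \<open>The summand \<open>1\<close> keeps \<open>c\<close> positive when \<open>R = 0\<close>.\<close>
  define c where "c = norm R + 1"
  have c: "c > 0" by (simp add: c_def add_nonneg_pos)
  define T where "T = id_blinfun - (1/c) *\<^sub>R R"
  have T_apply: "T x = x - (1/c) *\<^sub>R R x" for x
    by (simp add: T_def blinfun.diff_left blinfun.scaleR_left)
  have R_lin: "R (d *\<^sub>C x) = d *\<^sub>C R x" for d x
    using R by (simp add: positive_ops_def complex_linear_def)
  have R_sym: "inner x (R y) = inner (R x) y" for x y
    by (rule positive_op_inner(1)[OF R])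
  have T_form: "inner x (T x) = (norm x)\<^sup>2 - inner x (R x) / c" for x
    by (simp add: T_apply inner_diff_right dot_square_norm)
  have T_sym: "inner x (T y) = inner (T x) y" for x y
    by (simp add: T_apply inner_diff_left inner_diff_right R_sym)
  have comm: "f (T x) = T (f x)" if "bounded_linear f" "\<And>x. f (R x) = R (f x)" for f x
    using that by (simp add: T_apply linear_diff linear_cmul bounded_linear.linear)
  have "T \<in> positive_ops"
  proof (rule positive_opsI)
    show "complex_linear T"
      unfolding complex_linear_def
      using comm[OF bounded_linear_scaleC] R_lin by metis
    show "0 \<le> inner x (T x)" for x
    proof -
      have "inner x (R x) \<le> norm x * norm (R x)"
        by (rule norm_cauchy_schwarz)
      also have "\<dots> \<le> norm x * (norm R * norm x)"
        by (intro mult_left_mono norm_blinfun) simp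
      also have "\<dots> \<le> c * (norm x)\<^sup>2"
        by (simp add: c_def power2_eq_square algebra_simps)
      finally show ?thesis
        using c by (simp add: T_form field_simps)
    qed
  qed (rule T_sym)
  then have T_norm: "norm T \<le> 1"
    by (rule positive_contraction_norm)
      (use c positive_op_inner(2)[OF R] in \<open>simp add: T_form\<close>)
  obtain S where S: "S o\<^sub>L S = id_blinfun - T" "\<And>x y. inner x (S y) = inner (S x) y"
    "\<And>x. 0 \<le> inner x (S x)"
    "in_bicommutant S T"
    using contraction_sqrt_complement[OF T_norm T_sym] by blast
  let ?S = "sqrt c *\<^sub>R S"
  have S_comm: "in_bicommutant ?S R"
  proof (rule in_bicommutantI)
    fix f x assume f: "bounded_linear f" "\<And>x. f (R x) = R (f x)"
    show "f (?S x) = ?S (f x)"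
      using in_bicommutantD[OF S(4) f(1) comm[OF f]] f(1)
      by (simp add: blinfun.scaleR_left linear_cmul bounded_linear.linear)
  qed
  show thesis
  proof (rule that[of ?S])
    show "?S \<in> positive_ops"
    proof (rule positive_opsI)
      show "complex_linear ?S"
        using in_bicommutant_complex_linear[OF S_comm] R by (simp add: positive_ops_def)
    qed (use S c in \<open>simp_all add: blinfun.scaleR_left\<close>)
    have "S (S x) = (1/c) *\<^sub>R R x" for x
      using arg_cong[OF S(1), of "\<lambda>A. A x"] by (simp add: T_apply blinfun.diff_left)
    then show "?S o\<^sub>L ?S = R"
      using c by (intro blinfun_eqI) (simp add: blinfun.scaleR_left blinfun.scaleR_right)
  qed (rule S_comm)
qed

text \<open>
  Put \<open>y = (S - S') x\<close>. Since \<open>S\<close> and \<open>S'\<close> commute, \<open>(S + S') y = (S\<^sup>2 - S'\<^sup>2) x = 0\<close>,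
  so the nonnegative numbers \<open>\<langle>y, S y\<rangle>\<close> and \<open>\<langle>y, S' y\<rangle>\<close> add up to \<open>0\<close>. Hence \<open>S y = S' y = 0\<close>, and
  \<open>\<parallel>y\<parallel>\<^sup>2 = \<langle>(S - S') y, x\<rangle> = 0\<close>.
\<close>

lemma positive_sqrt_unique:
  assumes S: "S \<in> positive_ops" and S': "S' \<in> positive_ops"
    and sq: "S o\<^sub>L S = S' o\<^sub>L S'" and comm: "\<And>x. S' (S x) = S (S' x)"
  shows "S = S'"
proof (rule blinfun_eqI)
  fix x
  define y where "y = S x - S' x"
  have sq': "S (S x) = S' (S' x)" for x
    using sq by (metis blinfun_apply_blinfun_compose)
  have "S y + S' y = 0"
    by (simp add: y_def blinfun.diff_right sq' comm)
  then have "inner y (S y) + inner y (S' y) = 0"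
    by (metis inner_add_right inner_zero_right)
  then have "inner y (S y) = 0" "inner y (S' y) = 0"
    using positive_op_inner(2)[OF S, of y] positive_op_inner(2)[OF S', of y] by linarith+
  then have "S y = 0" "S' y = 0"
    using positive_op_form_zero S S' by blast+
  then have "inner y (S x) = 0" "inner y (S' x) = 0"
    using positive_op_inner(1)[OF S, of y x] positive_op_inner(1)[OF S', of y x] by simp_all
  then have "inner y (S x - S' x) = 0"
    by (simp add: inner_diff_right)
  then show "S x = S' x"
    by (simp add: y_def)
qed

text \<open>
  Any positive root \<open>S'\<close> of \<open>R\<close> commutes with \<open>R = S'\<^sup>2\<close>, hence with the root in the bicommutant
  of \<open>R\<close>. So \<open>positive_sqrt_unique\<close> applies to every competitor, and the definite description
  denotes that root.
\<close>

lemma op_sqrt_spec: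
  assumes R: "R \<in> positive_ops"
  shows "op_sqrt R \<in> positive_ops" "op_sqrt R (op_sqrt R x) = R x"
proof -
  obtain S where S: "S \<in> positive_ops" "S o\<^sub>L S = R"
    and comm: "in_bicommutant S R"
    using positive_sqrt_exists[OF R] by blast
  have eq: "op_sqrt R = S"
    unfolding op_sqrt_def
  proof (rule the_equality)
    fix S' assume S': "S' \<in> positive_ops \<and> S' o\<^sub>L S' = R"
    then have "S' (R x) = R (S' x)" for x
      by auto
    then have "S' (S x) = S (S' x)" for x
      by (intro in_bicommutantD[OF comm] blinfun.bounded_linear_right)
    moreover have "S o\<^sub>L S = S' o\<^sub>L S'"
      using S(2) S' by metis
    ultimately show "S' = S"
      using positive_sqrt_unique[of S S'] S(1) S' by metis
  qed (use S in blast)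
  show "op_sqrt R \<in> positive_ops"
    unfolding eq by (rule S(1))
  show "op_sqrt R (op_sqrt R x) = R x"
    unfolding eq blinfun_apply_blinfun_compose[symmetric] S(2) ..
qed

lemma op_sqrt_inner:
  assumes R: "R \<in> positive_ops"
  shows "inner x (R x) = (norm (op_sqrt R x))\<^sup>2"
  unfolding power2_norm_eq_inner positive_op_inner(1)[OF op_sqrt_spec(1)[OF R], symmetric] op_sqrt_spec(2)[OF R] ..

text \<open>
  \<open>R\<close> and its square root have the same kernel, because
  \<open>\<parallel>R\<^sup>1\<^sup>/\<^sup>2z\<parallel>\<^sup>2 = \<langle>z, R z\<rangle>\<close>.
\<close>

lemma op_sqrt_eq_iff:
  assumes R: "R \<in> positive_ops"
  shows "op_sqrt R x = op_sqrt R y \<longleftrightarrow> R x = R y"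
proof
  assume "op_sqrt R x = op_sqrt R y"
  then have "op_sqrt R (op_sqrt R x) = op_sqrt R (op_sqrt R y)"
    by simp
  then show "R x = R y"
    unfolding op_sqrt_spec(2)[OF R] .
next
  assume "R x = R y"
  then have "(norm (op_sqrt R (x - y)))\<^sup>2 = 0"
    unfolding op_sqrt_inner[OF R, symmetric] by (simp add: blinfun.diff_right)
  then show "op_sqrt R x = op_sqrt R y"
    by (simp add: blinfun.diff_right)
qed

section \<open>Orthogonal decomposition along the support\<close>

text \<open>
  A sequence in \<open>M\<close> that minimizes the distance to \<open>x\<close> is Cauchy by the parallelogram law, since
  the midpoint of two of its terms is no closer to \<open>x\<close> than the infimum. Its limit is the point of
  \<open>M\<close> closest to \<open>x\<close>, and at a closest point the residual is orthogonal to \<open>M\<close>.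
\<close>

lemma closed_subspace_projection:
  fixes M :: "'a::{real_inner,banach} set"
  assumes M: "subspace M" "closed M"
  obtains p where "p \<in> M" "\<forall>m\<in>M. inner (x - p) m = 0"
proof -
  define d where "d = infdist x M"
  have ne: "M \<noteq> {}" using subspace_0[OF M(1)] by blast
  have d0: "0 \<le> d" by (simp add: d_def infdist_nonneg)
  have d_le: "d \<le> norm (x - m)" if "m \<in> M" for m
    using infdist_le[OF that, of x] by (simp add: d_def dist_norm)
  have "\<exists>m\<in>M. norm (x - m) < d + 1 / Suc n" for n
    using cInf_lessD[of "(\<lambda>m. dist x m) ` M" "d + 1 / Suc n"] ne
    by (auto simp: d_def infdist_def dist_norm)
  then obtain m where mM: "\<And>n. m n \<in> M" and m: "\<And>n. norm (x - m n) < d + 1 / Suc n"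
    by metis
  have para: "(norm (m k - m l))\<^sup>2 \<le> 2 * (norm (x - m k))\<^sup>2 + 2 * (norm (x - m l))\<^sup>2 - 4 * d\<^sup>2" for k l
  proof -
    have "(1/2) *\<^sub>R (m k + m l) \<in> M"
      by (intro subspace_scale[OF M(1)] subspace_add[OF M(1)] mM)
    then have "d\<^sup>2 \<le> (norm (x - (1/2) *\<^sub>R (m k + m l)))\<^sup>2"
      using d_le d0 by (intro power_mono)
    moreover have "2 *\<^sub>R (x - (1/2) *\<^sub>R (m k + m l)) = (x - m k) + (x - m l)"
      by (simp add: scaleR_right_diff_distrib) (simp add: scaleR_2)
    from arg_cong[OF this, of "\<lambda>v. (norm v)\<^sup>2"]
    have "4 * (norm (x - (1/2) *\<^sub>R (m k + m l)))\<^sup>2 = (norm ((x - m k) + (x - m l)))\<^sup>2"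
      by (simp add: power_mult_distrib)
    moreover have "(norm (m k - m l))\<^sup>2 + (norm ((x - m k) + (x - m l)))\<^sup>2
        = 2 * (norm (x - m k))\<^sup>2 + 2 * (norm (x - m l))\<^sup>2"
      by (simp add: power2_norm_eq_inner inner_diff_left inner_diff_right inner_add_left
          inner_add_right inner_commute algebra_simps)
    ultimately show ?thesis by linarith
  qed
  have "(\<lambda>n. norm (x - m n)) \<longlonglongrightarrow> d"
  proof (rule tendsto_sandwich[where f = "\<lambda>_. d"])
    show "(\<lambda>n. d + 1 / Suc n) \<longlonglongrightarrow> d"
      using tendsto_add[OF tendsto_const[of d] LIMSEQ_inverse_real_of_nat] 
      by (simp add: inverse_eq_divide)
    show "\<forall>\<^sub>F n in sequentially. norm (x - m n) \<le> d + 1 / Suc n"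
      by (intro always_eventually allI less_imp_le m)
  qed (use d_le mM in auto)
  then have sq: "(\<lambda>n. (norm (x - m n))\<^sup>2) \<longlonglongrightarrow> d\<^sup>2"
    by (rule tendsto_power)
  have "Cauchy m"
  proof (rule metric_CauchyI)
    fix e :: real assume e: "0 < e"
    then obtain N where N: "\<And>n. n \<ge> N \<Longrightarrow> \<bar>(norm (x - m n))\<^sup>2 - d\<^sup>2\<bar> < e\<^sup>2 / 4"
      using LIMSEQ_D[OF sq, of "e\<^sup>2 / 4"] by auto
    have "dist (m k) (m l) < e" if "k \<ge> N" "l \<ge> N" for k l
    proof -
      have "(norm (m k - m l))\<^sup>2 < e\<^sup>2"
        using para[of k l] N[OF that(1)] N[OF that(2)] by linarith
      then have "norm (m k - m l) < e"
        by (rule power2_less_imp_less) (use e in simp)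
      then show ?thesis
        by (simp add: dist_norm)
    qed
    then show "\<exists>N. \<forall>k\<ge>N. \<forall>l\<ge>N. dist (m k) (m l) < e" by blast
  qed
  then obtain p where p: "m \<longlonglongrightarrow> p"
    using Cauchy_convergent_iff convergent_def by blast
  have pM: "p \<in> M"
    using closed_sequentially[OF M(2)] mM p by blast
  have "norm (x - p) = d"
    using LIMSEQ_unique tendsto_norm[OF tendsto_diff[OF tendsto_const p]]
      \<open>(\<lambda>n. norm (x - m n)) \<longlonglongrightarrow> d\<close> by blast
  then have "\<forall>q\<in>M. dist x p \<le> dist x q"
    using d_le by (simp add: dist_norm)
  then have ortho: "inner (x - p) m' \<le> 0" if "m' \<in> M" for m'
    using any_closest_point_dot[OF subspace_imp_convex[OF M(1)] M(2) pM
        subspace_add[OF M(1) pM that], of x] by simp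
  show thesis
  proof (rule that[OF pM], intro ballI)
    fix m' assume m': "m' \<in> M"
    show "inner (x - p) m' = 0"
      using ortho[OF m'] ortho[OF subspace_neg[OF M(1) m']] by simp
  qed
qed

text \<open>
  The orthogonal projection \<open>p\<close> of \<open>x\<close> to the support: \<open>x - p\<close> is orthogonal to
  \<open>R R (x - p)\<close>, that is, \<open>\<parallel>R (x - p)\<parallel>\<^sup>2 = 0\<close>.
\<close>

lemma op_supp_decomposition:
  assumes R: "R \<in> positive_ops"
  obtains p where "p \<in> op_supp R" "R x = R p"
proof -
  have "closed (op_supp R)"
    by (simp add: op_supp_def)
  from closed_subspace_projection[OF op_supp_subspace this]
  obtain p where p: "p \<in> op_supp R" "\<forall>m\<in>op_supp R. inner (x - p) m = 0"
    by blast
  have "R (R (x - p)) \<in> op_supp R"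
    unfolding op_supp_def using closure_subset[of "range R"] by blast
  with p(2) have "inner (x - p) (R (R (x - p))) = 0"
    by (rule bspec)
  then have "inner (R (x - p)) (R (x - p)) = 0"
    by (simp only: positive_op_inner(1)[OF R, symmetric])
  then have "R (x - p) = 0"
    by simp
  then have "R x = R p"
    by (simp add: blinfun.diff_right)
  with p(1) show thesis
    by (rule that)
qed

section \<open>The quadratic form of the Moore-Penrose inverse\<close>

text \<open>
  Choose \<open>y\<^sub>k\<close> with \<open>R y\<^sub>k \<rightarrow> u\<close> and let \<open>x\<^sub>k\<close> be the projection of \<open>R\<^sup>1\<^sup>/\<^sup>2y\<^sub>k\<close> to the
  support. The projection changes a vector only by an element of the kernel of \<open>R\<^sup>1\<^sup>/\<^sup>2\<close>, so
  \<open>R\<^sup>1\<^sup>/\<^sup>2x\<^sub>k = R y\<^sub>k \<rightarrow> u\<close>. Hence \<open>R x\<^sub>k \<rightarrow> R\<^sup>1\<^sup>/\<^sup>2u\<close>, and the form has the values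
  \<open>\<langle>R x\<^sub>k, x\<^sub>k\<rangle> = \<parallel>R\<^sup>1\<^sup>/\<^sup>2x\<^sub>k\<parallel>\<^sup>2 \<rightarrow> \<parallel>u\<parallel>\<^sup>2\<close>. The same identity for differences shows that
  \<open>R x\<^sub>k\<close> is Cauchy for the form.
\<close>

lemma mp_form_op_sqrt:
  assumes R: "R \<in> positive_ops" and u: "u \<in> op_supp R"
  shows "mp_form R (op_sqrt R u) = of_real ((norm u)\<^sup>2)"
proof (rule mp_form_eqI[OF R])
  let ?S = "op_sqrt R"
  obtain r where r: "\<And>k. r k \<in> range R" "r \<longlonglongrightarrow> u"
    using u unfolding op_supp_def closure_sequential by blast
  then have "\<forall>k. \<exists>y. r k = R y"
    by blast
  then obtain y where y: "\<And>k. r k = R (y k)"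
    by metis
  have "\<exists>x. x \<in> op_supp R \<and> ?S x = R (y k)" for k
  proof -
    obtain x where x: "x \<in> op_supp R" "R (?S (y k)) = R x"
      using op_supp_decomposition[OF R] by metis
    then have "?S x = R (y k)"
      by (simp flip: op_sqrt_eq_iff[OF R] add: op_sqrt_spec(2)[OF R])
    with x show ?thesis by blast
  qed
  then obtain x where x: "\<And>k. x k \<in> op_supp R" and Sx: "\<And>k. ?S (x k) = R (y k)"
    by metis
  have Sx_lim: "(\<lambda>k. ?S (x k)) \<longlonglongrightarrow> u"
    using r(2) by (simp add: Sx flip: y)
  have dom: "R z \<in> mp_dom R" "cinner (R z) (mp_inv R (R z)) = of_real ((norm (?S z))\<^sup>2)"
    if "z \<in> op_supp R" for z
  proof -
    show "R z \<in> mp_dom R"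
      unfolding mp_dom_def using that blinfun.zero_right[of R]
      by (intro CollectI exI[of _ z] exI[of _ 0]) simp
    then show "cinner (R z) (mp_inv R (R z)) = of_real ((norm (?S z))\<^sup>2)"
      using mp_inv_eq[OF R that, of 0] positive_op_inner(3)[OF R, of z]
      by (simp add: op_sqrt_inner[OF R] flip: positive_op_selfadjoint[OF R])
  qed
  show "mp_form_limit R (?S u) (of_real ((norm u)\<^sup>2))"
    unfolding mp_form_limit_def
  proof (intro exI[of _ "\<lambda>k. R (x k)"] conjI allI impI)
    show "R (x k) \<in> mp_dom R" for k
      by (rule dom(1)[OF x])
    have "(\<lambda>k. ?S (?S (x k))) \<longlonglongrightarrow> ?S u"
      by (intro blinfun.tendsto tendsto_const Sx_lim)
    then show "(\<lambda>k. R (x k)) \<longlonglongrightarrow> ?S u"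
      by (simp add: op_sqrt_spec(2)[OF R])
    show "(\<lambda>k. cinner (R (x k)) (mp_inv R (R (x k)))) \<longlonglongrightarrow> of_real ((norm u)\<^sup>2)"
      unfolding dom(2)[OF x] by (intro tendsto_intros Sx_lim)
    fix e :: real assume e: "e > 0"
    then obtain N where N: "\<And>k l. k \<ge> N \<Longrightarrow> l \<ge> N \<Longrightarrow> norm (?S (x k) - ?S (x l)) < sqrt e"
      using CauchyD[OF LIMSEQ_imp_Cauchy[OF Sx_lim], of "sqrt e"] by auto
    have "cmod (cinner (R (x k) - R (x l)) (mp_inv R (R (x k) - R (x l)))) < e"
      if "k \<ge> N" "l \<ge> N" for k l
    proof -
      have "cinner (R (x k) - R (x l)) (mp_inv R (R (x k) - R (x l)))
          = of_real ((norm (?S (x k) - ?S (x l)))\<^sup>2)"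
        using dom(2)[OF subspace_diff[OF op_supp_subspace x x], of k l]
        by (simp add: blinfun.diff_right)
      moreover have "(norm (?S (x k) - ?S (x l)))\<^sup>2 < (sqrt e)\<^sup>2"
        using N[OF that] by (intro power_strict_mono) auto
      ultimately show ?thesis
        using e by (simp add: norm_power)
    qed
    then show "\<exists>N. \<forall>k\<ge>N. \<forall>l\<ge>N.
        cmod (cinner (R (x k) - R (x l)) (mp_inv R (R (x k) - R (x l)))) < e"
      by blast
  qed
qed

section \<open>Residual-weighted updates\<close>

lemma rw_update_eq:
  assumes R: "R \<in> positive_ops"
  shows "rw_update u R = R - rank_one (op_sqrt R u) (op_sqrt R u)"
proof (rule blinfun_eqI)
  fix x
  have "op_sqrt R (c *\<^sub>C y) = c *\<^sub>C op_sqrt R y" for c y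
    using op_sqrt_spec(1)[OF R] by (simp add: positive_ops_def complex_linear_def)
  then show "rw_update u R x = (R - rank_one (op_sqrt R u) (op_sqrt R u)) x"
    by (simp add: rw_update_def blinfun.diff_left blinfun.diff_right rank_one.rep_eq
        op_sqrt_spec(2)[OF R] positive_op_selfadjoint[OF op_sqrt_spec(1)[OF R]])
qed

text \<open>
  With \<open>E = R\<^sup>1\<^sup>/\<^sup>2u\<close>, Cauchy-Schwarz gives
  \<open>|\<langle>E, x\<rangle>|\<^sup>2 = |\<langle>u, R\<^sup>1\<^sup>/\<^sup>2x\<rangle>|\<^sup>2 \<le> \<parallel>R\<^sup>1\<^sup>/\<^sup>2x\<parallel>\<^sup>2 = \<langle>x, R x\<rangle>\<close>.
\<close>

lemma rw_update_positive:
  assumes R: "R \<in> positive_ops" and u: "norm u \<le> 1"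
  shows "rw_update u R \<in> positive_ops"
proof -
  let ?E = "op_sqrt R u"
  have update_apply: "rw_update u R x = R x - cinner ?E x *\<^sub>C ?E" for x
    by (simp add: rw_update_eq[OF R] blinfun.diff_left rank_one.rep_eq)
  have R_lin: "R (d *\<^sub>C x) = d *\<^sub>C R x" for d x
    using R by (simp add: positive_ops_def complex_linear_def)
  have form: "cinner x (cinner ?E y *\<^sub>C ?E) = cinner ?E y * cnj (cinner ?E x)" for x y
    using cinner_commute[of x ?E] by (simp add: cinner_scaleC_right)
  show ?thesis
  proof (rule positive_opsI)
    show "complex_linear (rw_update u R)"
      by (simp add: complex_linear_def update_apply R_lin cinner_scaleC_right scaleC_scaleC
          linear_diff[OF bounded_linear.linear[OF bounded_linear_scaleC]])
    show "inner x (rw_update u R y) = inner (rw_update u R x) y" for x y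
      using form[of x y] positive_op_inner(1)[OF R, of x y]
      by (simp add: update_apply inner_diff_left inner_diff_right)
        (simp add: inner_eq_Re_cinner cinner_scaleC_left)
    show "0 \<le> inner x (rw_update u R x)" for x
    proof -
      have "inner x (cinner ?E x *\<^sub>C ?E) = (cmod (cinner ?E x))\<^sup>2"
        by (simp only: inner_eq_Re_cinner form complex_norm_square[symmetric] Re_complex_of_real)
      also have "cinner ?E x = cinner u (op_sqrt R x)"
        by (rule positive_op_selfadjoint[OF op_sqrt_spec(1)[OF R], symmetric])
      also have "(cmod (cinner u (op_sqrt R x)))\<^sup>2 \<le> (norm (op_sqrt R x))\<^sup>2"
        using norm_cinner_le[of u "op_sqrt R x"] mult_right_mono[OF u norm_ge_zero[of "op_sqrt R x"]]
        by (intro power_mono) auto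
      finally show ?thesis
        by (simp add: update_apply inner_diff_right op_sqrt_inner[OF R]
            positive_op_selfadjoint[OF op_sqrt_spec(1)[OF R]])
    qed
  qed
qed

text \<open>
  A preimage of \<open>E\<close> under \<open>R\<^sup>1\<^sup>/\<^sup>2\<close> may have any kernel component. Its projection to the support is
  still a preimage, and \<open>mp_form_op_sqrt\<close> identifies the squared norm of that one with
  the value of the form at \<open>E\<close>.
\<close>

lemma unit_vector_of_normalized_residual:
  assumes R: "R \<in> positive_ops" and E: "E \<in> range (op_sqrt R)" and norm1: "mp_form R E = 1"
  obtains u where "norm u = 1" "E = op_sqrt R u"
proof -
  obtain v where v: "E = op_sqrt R v" using E by blast
  obtain u where u: "u \<in> op_supp R" "R v = R u"
    using op_supp_decomposition[OF R] by metis
  then have Eu: "E = op_sqrt R u"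
    by (simp add: v op_sqrt_eq_iff[OF R])
  then have "complex_of_real ((norm u)\<^sup>2) = of_real 1"
    using mp_form_op_sqrt[OF R u(1)] norm1 by simp
  then have "norm u = 1"
    using power2_eq_1_iff[of "norm u"] norm_ge_zero[of u] by (simp only: of_real_eq_iff) linarith
  with Eu that show thesis by blast
qed

theorem theorem3p5:
  shows "(\<forall>(R :: nat \<Rightarrow> 'a::complex_hilbert_space \<Rightarrow>\<^sub>L 'a) (E :: nat \<Rightarrow> 'a).
            (\<forall>n. R n \<in> positive_ops) \<and>
            (\<forall>n. R (Suc n) = R n - rank_one (E n) (E n)) \<and>
            (\<forall>n. E n \<noteq> 0 \<longrightarrow> E n \<in> range (op_sqrt (R n))) \<and>
            (\<forall>n. mp_form (R n) (E n) = 1)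
          \<longrightarrow> (\<exists>u :: nat \<Rightarrow> 'a.
                (\<forall>n. norm (u n) = 1) \<and>
                (\<forall>n. R (Suc n) = rw_update (u n) (R n) \<and>
                     rw_update (u n) (R n) =
                       op_sqrt (R n) o\<^sub>L (id_blinfun - rank_one (u n) (u n)) o\<^sub>L op_sqrt (R n)) \<and>
                (\<forall>n. E n = op_sqrt (R n) (u n)) \<and>
                rw_iteration R u \<and> E = rw_residual R u))
       \<and> (\<forall>(R :: nat \<Rightarrow> 'a \<Rightarrow>\<^sub>L 'a) (u :: nat \<Rightarrow> 'a) (E :: nat \<Rightarrow> 'a).
            R 0 \<in> positive_ops \<and>
            (\<forall>n. norm (u n) = 1) \<and>
            (\<forall>n. u n \<in> op_supp (R n)) \<and>
            (\<forall>n. R (Suc n) = rw_update (u n) (R n)) \<and>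
            (\<forall>n. E n = op_sqrt (R n) (u n))
          \<longrightarrow> (\<forall>n. E n \<in> range (op_sqrt (R n))) \<and>
              (\<forall>n. mp_form (R n) (E n) = 1))"
proof (intro conjI allI impI; elim conjE)
  fix R :: "nat \<Rightarrow> 'a \<Rightarrow>\<^sub>L 'a" and E :: "nat \<Rightarrow> 'a"
  assume R: "\<forall>n. R n \<in> positive_ops" and step: "\<forall>n. R (Suc n) = R n - rank_one (E n) (E n)"
    and ran: "\<forall>n. E n \<noteq> 0 \<longrightarrow> E n \<in> range (op_sqrt (R n))"
    and normalized: "\<forall>n. mp_form (R n) (E n) = 1"
  have "\<exists>u. norm u = 1 \<and> E n = op_sqrt (R n) u" for n
  proof -
    \<comment> \<open>If \<open>E n = 0\<close>, the zero vector is a preimage.\<close>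
    have "E n \<in> range (op_sqrt (R n))"
      using ran blinfun.zero_right[of "op_sqrt (R n)"] by (metis rangeI)
    then show ?thesis
      using unit_vector_of_normalized_residual R normalized by metis
  qed
  then obtain u where u: "\<And>n. norm (u n) = 1" "\<And>n. E n = op_sqrt (R n) (u n)"
    by metis
  have upd: "R (Suc n) = rw_update (u n) (R n)" for n
    using R step u(2) by (simp add: rw_update_eq)
  show "\<exists>u. (\<forall>n. norm (u n) = 1) \<and>
      (\<forall>n. R (Suc n) = rw_update (u n) (R n) \<and>
        rw_update (u n) (R n) =
          op_sqrt (R n) o\<^sub>L (id_blinfun - rank_one (u n) (u n)) o\<^sub>L op_sqrt (R n)) \<and>
      (\<forall>n. E n = op_sqrt (R n) (u n)) \<and> rw_iteration R u \<and> E = rw_residual R u"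
    using u upd R
    by (intro exI[of _ u]) (auto simp: rw_update_def rw_iteration_def rw_residual_def)
next
  fix R :: "nat \<Rightarrow> 'a \<Rightarrow>\<^sub>L 'a" and u E :: "nat \<Rightarrow> 'a" and n
  assume "\<forall>n. E n = op_sqrt (R n) (u n)"
  then show "E n \<in> range (op_sqrt (R n))" by simp
next
  fix R :: "nat \<Rightarrow> 'a \<Rightarrow>\<^sub>L 'a" and u E :: "nat \<Rightarrow> 'a" and n
  assume R0: "R 0 \<in> positive_ops" and u: "\<forall>n. norm (u n) = 1"
    and supp: "\<forall>n. u n \<in> op_supp (R n)" and upd: "\<forall>n. R (Suc n) = rw_update (u n) (R n)"
    and E: "\<forall>n. E n = op_sqrt (R n) (u n)"
  have "R n \<in> positive_ops"
  proof (induction n)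
    case (Suc n)
    then show ?case
      using rw_update_positive[of "R n" "u n"] u upd by simp
  qed (rule R0)
  then show "mp_form (R n) (E n) = 1"
    using mp_form_op_sqrt[of "R n" "u n"] supp u E by simp
qed

end
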